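(* Let $G$ be a finite simple graph, $q\ge 1$ an integer, and $\bm{\lambda}^{(i)}=(\lambda^{(i)}_v)_{v\in V(G)}$, $1\le i\le q$, tuples of nonnegative reals. Write $d_v\coloneqq\deg_G(v)$. Then \[ Z^{(q)}_G(\bm{\lambda}^{(1)},\dots,\bm{\lambda}^{(q)})\ \ge\ \prod_{v\in V(G)}\prod_{i=1}^{q}Z_{K_{d_v+q}}(\lambda^{(i)}_v)^{1/(d_v+q)}. \] In particular, if $\lambda^{(i)}_v=o(1/\Delta(G))$ for all $v\in V(G)$ and $1\le i\le q$, then as $\Delta(G)\to\infty$, \[ Z^{(q)}_G(\bm{\lambda}^{(1)},\dots,\bm{\lambda}^{(q)})\ \ge\ \prod_{v\in V(G)}\Bigl(Z^{(q)}_{K_{d_v+1}}(\lambda^{(1)}_v,\dots,\lambda^{(q)}_v)^{\frac{1}{d_v+1}}+o\Bigl(\sum_{i=1}^{q}\lambda^{(i)}_v\Bigr)\Bigr). \] If in addition, for each $v\in V(G)$, $\lambda^{(1)}_v=\dots=\lambda^{(q)}_v\eqqcolon\lambda_v$, then \[ Z^{(q)}_G(\bm{\lambda}^{(1)},\dots,\bm{\lambda}^{(q)})\ \ge\ \prod_{v\in V(G)}\Bigl(Z^{(q)}_{K_{d_v+1}}(\lambda_v,\dots,\lambda_v)^{\frac{1}{d_v+1}}+o((q\lambda_v)^2)\Bigr). \]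
   Context: $\mathcal{I}(G)$ is the set of independent sets of $G$ (including the empty set); $Z_G(\lambda)\coloneqq\sum_{I\in\mathcal{I}(G)}\lambda^{|I|}$, so $Z_{K_m}(\lambda)=1+m\lambda$ for the complete graph $K_m$. $\mathcal{I}^{(q)}(G)$ is the set of $q$-tuples $(I_1,\dots,I_q)$ of pairwise disjoint (possibly empty) independent sets of $G$. For tuples $\bm{\lambda}^{(i)}=(\lambda^{(i)}_v)_{v\in V(G)}$, $Z^{(q)}_G(\bm{\lambda}^{(1)},\dots,\bm{\lambda}^{(q)})\coloneqq\sum_{(I_1,\dots,I_q)\in\mathcal{I}^{(q)}(G)}\prod_{i=1}^q\prod_{v\in I_i}\lambda^{(i)}_v$; for scalars, $Z^{(q)}_{G}(\lambda^{(1)},\dots,\lambda^{(q)})\coloneqq\sum_{(I_1,\dots,I_q)\in\mathcal{I}^{(q)}(G)}\prod_{i=1}^q(\lambda^{(i)})^{|I_i|}$. $\Delta(G)$ is the maximum degree of $G$. *)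

theory Defs
  imports
    Complex_Main
    "HOL-Library.FuncSet"
    "HOL-Library.Disjoint_Sets"
    "HOL-Library.Ramsey"
    "HOL-Library.Landau_Symbols"
begin

type_synonym 'a graph = "'a set \<times> 'a set set"

abbreviation verts :: "'a graph \<Rightarrow> 'a set" where "verts G \<equiv> fst G"

abbreviation edges :: "'a graph \<Rightarrow> 'a set set" where "edges G \<equiv> snd G"

definition simple_graph :: "'a graph \<Rightarrow> bool" where
  "simple_graph G \<longleftrightarrow> finite (verts G) \<and> edges G \<subseteq> [verts G]\<^bsup>2\<^esup>"

definition vdegree :: "'a graph \<Rightarrow> 'a \<Rightarrow> nat" where
  "vdegree G v = card {e \<in> edges G. v \<in> e}"

(* The inserted 0 only matters for the graph without vertices. *)
definition max_degree :: "'a graph \<Rightarrow> nat" where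
  "max_degree G = Max (insert 0 (vdegree G ` verts G))"

definition complete_graph :: "nat \<Rightarrow> nat graph" where
  "complete_graph m = ({..<m}, [{..<m}]\<^bsup>2\<^esup>)"

definition independent_sets :: "'a graph \<Rightarrow> 'a set set" where
  "independent_sets G = {I. I \<subseteq> verts G \<and> indep I (edges G)}"

definition Z :: "'a graph \<Rightarrow> real \<Rightarrow> real" where
  "Z G x = (\<Sum>I \<in> independent_sets G. x ^ card I)"

(* q-tuples are extensional functions on {1..q}.  Disjointness is required of different
   positions i, j, so the empty set may occur several times in a tuple. *)
definition independent_tuples :: "nat \<Rightarrow> 'a graph \<Rightarrow> (nat \<Rightarrow> 'a set) set" where
  "independent_tuples q G =
     {I \<in> {1..q} \<rightarrow>\<^sub>E independent_sets G. disjoint_family_on I {1..q}}"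

(* Vertex-dependent fugacities: lam i v is the weight of vertex v in the i-th set. *)
definition Zq :: "nat \<Rightarrow> 'a graph \<Rightarrow> (nat \<Rightarrow> 'a \<Rightarrow> real) \<Rightarrow> real" where
  "Zq q G lam = (\<Sum>I \<in> independent_tuples q G. \<Prod>i=1..q. \<Prod>v\<in>I i. lam i v)"

(* Scalar fugacities. *)
definition Zq_scalar :: "nat \<Rightarrow> 'a graph \<Rightarrow> (nat \<Rightarrow> real) \<Rightarrow> real" where
  "Zq_scalar q G x = (\<Sum>I \<in> independent_tuples q G. \<Prod>i=1..q. x i ^ card (I i))"

(* For a family of graphs G n, the filter of pairs (n, v) with v a vertex of G n and n going
   along F.  Landau symbols with respect to it are uniform in the vertex, see the lemmas
   below. *)
definition vertex_filter :: "'i filter \<Rightarrow> ('i \<Rightarrow> 'a graph) \<Rightarrow> ('i \<times> 'a) filter" where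
  "vertex_filter F G = inf (filtercomap fst F) (principal (SIGMA n:UNIV. verts (G n)))"

lemma eventually_vertex_filter:
  "eventually P (vertex_filter F G) \<longleftrightarrow> (\<forall>\<^sub>F n in F. \<forall>v\<in>verts (G n). P (n, v))"
  unfolding vertex_filter_def eventually_inf_principal eventually_filtercomap
  by (auto elim!: eventually_mono)

lemma smallo_vertex_filter:
  fixes f g :: "'i \<Rightarrow> 'a \<Rightarrow> real"
  shows "(\<lambda>(n, v). f n v) \<in> o[vertex_filter F G](\<lambda>(n, v). g n v) \<longleftrightarrow>
    (\<forall>c>0. \<forall>\<^sub>F n in F. \<forall>v\<in>verts (G n). \<bar>f n v\<bar> \<le> c * \<bar>g n v\<bar>)"
  by (simp add: smallo_def eventually_vertex_filter)

lemma Z_complete_graph: "Z (complete_graph m) x = 1 + real m * x"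
proof -
  have "I = {} \<or> (\<exists>v<m. I = {v})" if "I \<in> independent_sets (complete_graph m)" for I
  proof (rule ccontr)
    assume neg: "\<not> (I = {} \<or> (\<exists>v<m. I = {v}))"
    have I: "I \<subseteq> {..<m}" "indep I ([{..<m}]\<^bsup>2\<^esup>)"
      using that by (auto simp: independent_sets_def complete_graph_def)
    obtain v w where vw: "v \<in> I" "w \<in> I" "v \<noteq> w"
      using neg I(1) by blast
    then have "{v, w} \<in> [{..<m}]\<^bsup>2\<^esup>" using I(1) by (auto simp: nsets_def)
    then show False using I(2) vw by (auto simp: indep_def)
  qed
  moreover have "{} \<in> independent_sets (complete_graph m)"
    "\<And>v. v < m \<Longrightarrow> {v} \<in> independent_sets (complete_graph m)"
    by (auto simp: independent_sets_def complete_graph_def indep_def)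
  ultimately have "independent_sets (complete_graph m) = insert {} ((\<lambda>v. {v}) ` {..<m})"
    by blast
  then show ?thesis
    by (simp add: Z_def sum.reindex image_iff)
qed

end

(*
  For q = 1 the bound Z >= prod_v (1 + (d_v + 1) w_v)^(1/(d_v + 1)) is proved by induction on the
  number of vertices, for arbitrary vertex weights w.  Let u be a vertex of maximum degree D and
  use Z_G = Z_(G - u) + w_u Z_(G - N[u]).  After the induction hypothesis, Young's inequality
  eliminates w_u, and what is left is an inequality for the D neighbours of u.  It follows from
  Mahler's inequality once each neighbour, of degree d <= D, satisfies
    (D + 1) (1 + d x)^(D/d) >= 1 + D (1 + (d + 1) x)^((D + 1)/(d + 1)).

  For general q, independent q-tuples of G are the independent sets of the Cartesian product of G
  and K_q, in which every copy of v has degree d_v + q - 1.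

  The asymptotic bounds only need upper bounds for Zq of K_n, n = d + 1.  Dropping disjointness
  gives (1 + n x)^q for equal fugacities, and removing the tuples with two equal singletons gives
  (1 + n x)^q - (q choose 2) n x^2, which is accurate to the order required.
*)
theory Submission
  imports Defs "HOL-Analysis.Convex"
begin

section \<open>Analytic inequalities behind the deletion of a vertex\<close>

text \<open>Divide by \<open>prod c K\<close>. The inequality of arithmetic and geometric means
  replaces each product of ratios by the average of their \<open>card K\<close>-th powers, and
  \<open>le\<close> bounds the weighted sum at each single \<open>v\<close> by
  \<open>p + r\<close>.\<close>

lemma weighted_Mahler_inequality:
  fixes a b c :: "'b \<Rightarrow> real"
  assumes "finite K" "K \<noteq> {}" "p \<ge> 0" "r \<ge> 0"
    and "\<And>v. v \<in> K \<Longrightarrow> a v \<ge> 0" "\<And>v. v \<in> K \<Longrightarrow> b v \<ge> 0" "\<And>v. v \<in> K \<Longrightarrow> c v > 0"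
    and le: "\<And>v. v \<in> K \<Longrightarrow> p * a v ^ card K + r * b v ^ card K \<le> (p + r) * c v ^ card K"
  shows "p * prod a K + r * prod b K \<le> (p + r) * prod c K"
proof -
  define D where "D = card K"
  have D: "D > 0" using assms by (simp add: D_def card_gt_0_iff)
  have amgm: "prod x K \<le> (\<Sum>v\<in>K. x v ^ D) / D" if x: "\<And>v. v \<in> K \<Longrightarrow> x v \<ge> 0" for x :: "'b \<Rightarrow> real"
  proof -
    have "prod x K = (prod x K ^ D) powr (1 / D)"
      using D x by (simp add: powr_powr prod_nonneg flip: powr_realpow')
    also have "\<dots> = (\<Prod>v\<in>K. x v ^ D) powr (1 / D)" by (simp add: prod_power_distrib)
    also have "\<dots> \<le> (\<Sum>v\<in>K. x v ^ D / D)"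
      unfolding D_def using assms x by (intro arith_geom_mean) auto
    finally show ?thesis by (simp add: sum_divide_distrib)
  qed
  have C: "prod c K > 0" using assms by (simp add: prod_pos)
  have "p * (prod a K / prod c K) + r * (prod b K / prod c K)
      = p * (\<Prod>v\<in>K. a v / c v) + r * (\<Prod>v\<in>K. b v / c v)"
    by (simp add: prod_dividef)
  also have "\<dots> \<le> p * ((\<Sum>v\<in>K. (a v / c v) ^ D) / D) + r * ((\<Sum>v\<in>K. (b v / c v) ^ D) / D)"
    using assms by (intro add_mono mult_left_mono amgm) (auto intro!: divide_nonneg_pos)
  also have "\<dots> = (\<Sum>v\<in>K. (p * a v ^ D + r * b v ^ D) / c v ^ D) / D"
    by (simp add: sum.distrib add_divide_distrib sum_distrib_left power_divide sum_divide_distrib)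
  also have "\<dots> \<le> (\<Sum>v\<in>K. p + r) / D"
    using assms by (intro divide_right_mono sum_mono) (auto simp: divide_le_eq D_def)
  also have "\<dots> = p + r" using D by (simp add: D_def)
  finally show ?thesis using C by (simp add: field_simps)
qed

text \<open>The \<open>(d + 1)\<close>-th root of the independence polynomial of the complete graph
  on \<open>d + 1\<close> vertices. It is the contribution of a vertex of degree \<open>d\<close> to
  the lower bound.\<close>

definition hc_factor :: "nat \<Rightarrow> real \<Rightarrow> real" where
  "hc_factor d x = (1 + (real d + 1) * x) powr (1 / (real d + 1))"

text \<open>Bernoulli's inequality for the exponent \<open>m / n\<close>, which is at most 1. It is
  Young's inequality with 1 as the second factor; an \<open>m\<close>-th root then gives the
  claim.\<close>

lemma Bernoulli_powr_antimono:
  fixes x :: real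
  assumes "0 < m" "m \<le> n" "x \<ge> 0"
  shows "(1 + n * x) powr (1 / n) \<le> (1 + m * x) powr (1 / m)"
proof -
  have "(1 + n * x) powr (m / n) * 1 powr (1 - m / n) \<le> m / n * (1 + n * x) + (1 - m / n) * 1"
    using assms by (intro Youngs_inequality_0) (auto intro: add_pos_nonneg)
  also have "\<dots> = 1 + m * x" using assms by (simp add: field_simps)
  finally have "((1 + n * x) powr (m / n)) powr (1 / m) \<le> (1 + m * x) powr (1 / m)"
    using assms by (intro powr_mono2) auto
  then show ?thesis using assms by (simp add: powr_powr)
qed

lemma hc_factor_antimono: "d \<le> e \<Longrightarrow> x \<ge> 0 \<Longrightarrow> hc_factor e x \<le> hc_factor d x"
  unfolding hc_factor_def by (rule Bernoulli_powr_antimono) auto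

lemma hc_factor_pos: "x \<ge> 0 \<Longrightarrow> hc_factor d x > 0"
  unfolding hc_factor_def by (simp add: add_pos_nonneg less_imp_neq[symmetric])

(* Both sides agree at x = 0 and their derivatives compare by Bernoulli_powr_antimono. *)
lemma degree_reduction_inequality:
  fixes x d D :: real
  assumes "1 \<le> d" "d \<le> D" "x \<ge> 0"
  shows "1 + D * (1 + (d + 1) * x) powr ((D + 1) / (d + 1)) \<le> (D + 1) * (1 + d * x) powr (D / d)"
proof -
  define g where "g t = (D + 1) * (1 + d * t) powr (D / d) - D * (1 + (d + 1) * t) powr ((D + 1) / (d + 1))" for t
  have der: "\<exists>y. DERIV g t :> y \<and> y \<ge> 0" if t: "0 \<le> t" for t
  proof -
    have p: "1 + d * t > 0" "1 + (d + 1) * t > 0" using assms t by (auto intro!: add_pos_nonneg)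
    have powr': "DERIV (\<lambda>t. (1 + c * t) powr r) t :> r * (1 + c * t) powr (r - 1) * c" if "1 + c * t > 0" for c r :: real
      using DERIV_fun_powr[of "\<lambda>t. 1 + c * t" c t r] that by (auto intro!: derivative_eq_intros)
    define y where "y = (D + 1) * D * ((1 + d * t) powr ((D - d) / d) - (1 + (d + 1) * t) powr ((D - d) / (d + 1)))"
    \<comment> \<open>Lowering both exponents by one leaves the same numerator \<open>D - d\<close>,
      so the two powers in \<open>y\<close> are the \<open>(D - d)\<close>-th powers of the
      quantities that \<open>Bernoulli_powr_antimono\<close> compares.\<close>
    have e: "D / d - 1 = (D - d) / d" "(D + 1) / (d + 1) - 1 = (D - d) / (d + 1)"
      using assms by (auto simp: field_simps)
    have eq: "(D + 1) * (D / d * A * d) - D * ((D + 1) / (d + 1) * B * (d + 1)) = (D + 1) * D * (A - B)"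
      if "d \<noteq> 0" "d + 1 \<noteq> 0" for A B :: real
    proof -
      have *: "D / d * A * d = D * A" "(D + 1) / (d + 1) * B * (d + 1) = (D + 1) * B"
        using that by simp_all
      show ?thesis unfolding * by (simp add: algebra_simps)
    qed
    have D: "DERIV g t :> y"
    proof (rule DERIV_cong)
      show "DERIV g t :> (D + 1) * (D / d * (1 + d * t) powr (D / d - 1) * d)
          - D * ((D + 1) / (d + 1) * (1 + (d + 1) * t) powr ((D + 1) / (d + 1) - 1) * (d + 1))"
        unfolding g_def by (intro DERIV_diff DERIV_cmult powr' p)
      show "(D + 1) * (D / d * (1 + d * t) powr (D / d - 1) * d)
          - D * ((D + 1) / (d + 1) * (1 + (d + 1) * t) powr ((D + 1) / (d + 1) - 1) * (d + 1)) = y"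
        unfolding y_def e using assms by (intro eq) auto
    qed
    have "((1 + (d + 1) * t) powr (1 / (d + 1))) powr (D - d) \<le> ((1 + d * t) powr (1 / d)) powr (D - d)"
      using assms t by (intro powr_mono2 Bernoulli_powr_antimono) auto
    then have "y \<ge> 0" unfolding y_def using assms by (simp add: powr_powr)
    with D show ?thesis by blast
  qed
  have "g 0 \<le> g x" by (rule DERIV_nonneg_imp_nondecreasing[OF assms(3) der])
  then show ?thesis by (simp add: g_def)
qed

text \<open>What the induction needs when a vertex of weight \<open>x\<close> with neighbourhood
  \<open>K\<close> is deleted: the degrees on \<open>K\<close> drop from \<open>d v\<close> to
  \<open>d v - 1\<close>, and the factors of all other vertices are common to both sides. The bound
  of \<open>d v\<close> by \<open>card K\<close> is where the maximality of the degree of the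
  deleted vertex enters.\<close>

lemma vertex_deletion_inequality:
  fixes d :: "'b \<Rightarrow> nat" and w :: "'b \<Rightarrow> real"
  assumes K: "finite K" and d: "\<And>v. v \<in> K \<Longrightarrow> 1 \<le> d v \<and> d v \<le> card K"
    and w: "\<And>v. v \<in> K \<Longrightarrow> w v \<ge> 0" and x: "x \<ge> 0"
  shows "hc_factor (card K) x * (\<Prod>v\<in>K. hc_factor (d v) (w v)) \<le> (\<Prod>v\<in>K. hc_factor (d v - 1) (w v)) + x"
proof (cases "K = {}")
  case True
  then show ?thesis using x by (simp add: hc_factor_def)
next
  case False
  define D where "D = real (card K)"
  have D: "D \<ge> 1" using K False by (simp add: D_def Suc_le_eq card_gt_0_iff)
  have D0: "card K > 0" using K False by (simp add: card_gt_0_iff)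
  \<comment> \<open>The exponent makes \<open>\<beta> v ^ card K\<close> the power that occurs in
    \<open>degree_reduction_inequality\<close>, while the \<open>D / (D + 1)\<close>-th power of
    \<open>\<beta> v\<close> is the original factor, as Young's inequality requires.\<close>
  define \<beta> where "\<beta> v = hc_factor (d v) (w v) powr ((D + 1) / D)" for v
  have pos: "hc_factor (d v) (w v) > 0" "hc_factor (d v - 1) (w v) > 0" if "v \<in> K" for v
    using that w by (auto intro: hc_factor_pos)
  have \<beta>_pos: "\<beta> v > 0" if "v \<in> K" for v using pos that by (simp add: \<beta>_def less_imp_neq[symmetric])
  have "1 * (\<Prod>v\<in>K. 1) + D * prod \<beta> K \<le> (1 + D) * (\<Prod>v\<in>K. hc_factor (d v - 1) (w v))"
  proof (rule weighted_Mahler_inequality)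
    fix v assume v: "v \<in> K"
    have "real (d v) \<ge> 1" "real (d v) \<le> D" using d[OF v] by (auto simp: D_def)
    moreover have "\<beta> v ^ card K = (1 + (real (d v) + 1) * w v) powr ((D + 1) / (real (d v) + 1))"
      using \<beta>_pos[OF v] D by (simp add: powr_realpow[symmetric] \<beta>_def hc_factor_def powr_powr D_def[symmetric])
    moreover have "hc_factor (d v - 1) (w v) ^ card K = (1 + real (d v) * w v) powr (D / real (d v))"
      using pos[OF v] D d[OF v] by (simp add: powr_realpow[symmetric] hc_factor_def powr_powr D_def[symmetric] of_nat_diff)
    ultimately show "1 * 1 ^ card K + D * \<beta> v ^ card K \<le> (1 + D) * hc_factor (d v - 1) (w v) ^ card K"
      using degree_reduction_inequality[of "real (d v)" D "w v"] w[OF v] by (simp add: add.commute)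
  qed (use K False D \<beta>_pos pos in \<open>auto intro: less_imp_le\<close>)
  then have 1: "(1 + D * prod \<beta> K) / (D + 1) \<le> (\<Prod>v\<in>K. hc_factor (d v - 1) (w v))"
    using D by (simp add: divide_le_eq algebra_simps)
  have P: "prod \<beta> K > 0" using \<beta>_pos by (simp add: prod_pos)
  have "prod \<beta> K powr (D / (D + 1)) = (\<Prod>v\<in>K. hc_factor (d v) (w v))"
    unfolding prod_powr_distrib using pos D
    by (intro prod.cong refl) (auto simp: \<beta>_def powr_powr less_imp_le)
  moreover have conv: "D / (D + 1) + 1 / (D + 1) = 1" using D by (simp flip: add_divide_distrib)
  \<comment> \<open>Young's inequality with conjugate weights \<open>D / (D + 1)\<close> and
    \<open>1 / (D + 1)\<close>. On its right side \<open>x\<close> occurs only as the summand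
    \<open>x\<close>, which cancels against the claim and leaves fact \<open>1\<close>.\<close>
  then have "prod \<beta> K powr (D / (D + 1)) * (1 + (D + 1) * x) powr (1 / (D + 1))
      \<le> D / (D + 1) * prod \<beta> K + 1 / (D + 1) * (1 + (D + 1) * x)"
    using D P x conv by (intro Youngs_inequality_0) (auto intro: add_pos_nonneg)
  moreover have "D / (D + 1) * prod \<beta> K + 1 / (D + 1) * (1 + (D + 1) * x) = (1 + D * prod \<beta> K) / (D + 1) + x"
    using D by (simp add: add_divide_distrib)
  ultimately show ?thesis using 1 by (simp add: hc_factor_def D_def mult.commute)
qed

section \<open>The lower bound for weighted independent sets\<close>

text \<open>The relation \<open>adj\<close> stays fixed and the vertex set is a separate argument,
  so that passing to an induced subgraph only shrinks \<open>S\<close>.\<close>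

definition hc_indep :: "('b \<Rightarrow> 'b \<Rightarrow> bool) \<Rightarrow> 'b set \<Rightarrow> 'b set set" where
  "hc_indep adj S = {I. I \<subseteq> S \<and> (\<forall>x\<in>I. \<forall>y\<in>I. \<not> adj x y)}"

definition hc_Z :: "('b \<Rightarrow> 'b \<Rightarrow> bool) \<Rightarrow> ('b \<Rightarrow> real) \<Rightarrow> 'b set \<Rightarrow> real" where
  "hc_Z adj w S = (\<Sum>I\<in>hc_indep adj S. \<Prod>v\<in>I. w v)"

definition hc_deg :: "('b \<Rightarrow> 'b \<Rightarrow> bool) \<Rightarrow> 'b set \<Rightarrow> 'b \<Rightarrow> nat" where
  "hc_deg adj S v = card {x \<in> S. adj v x}"

text \<open>Split the independent sets by whether they contain \<open>u\<close>. Those that do arise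
  by inserting \<open>u\<close> into an independent set that avoids \<open>u\<close> and its
  neighbours.\<close>

lemma hc_Z_vertex_deletion:
  assumes "finite S" "u \<in> S" "symp adj" "irreflp adj"
  shows "hc_Z adj w S = hc_Z adj w (S - {u}) + w u * hc_Z adj w (S - insert u {x \<in> S. adj u x})"
proof -
  define T where "T = S - insert u {x \<in> S. adj u x}"
  have fin: "finite (hc_indep adj X)" if "X \<subseteq> S" for X
    by (rule finite_subset[of _ "Pow X"]) (use that assms in \<open>auto simp: hc_indep_def intro: finite_subset\<close>)
  have uT: "u \<notin> I" "finite I" if "I \<in> hc_indep adj T" for I
    using that assms(1) by (auto simp: hc_indep_def T_def intro: finite_subset)
  have "hc_indep adj S = hc_indep adj (S - {u}) \<union> insert u ` hc_indep adj T"
  proof (intro equalityI subsetI)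
    fix I assume I: "I \<in> hc_indep adj S"
    show "I \<in> hc_indep adj (S - {u}) \<union> insert u ` hc_indep adj T"
    proof (cases "u \<in> I")
      case True
      then have "I = insert u (I - {u})" "I - {u} \<in> hc_indep adj T"
        using I by (auto simp: hc_indep_def T_def)
      then show ?thesis by blast
    qed (use I in \<open>auto simp: hc_indep_def\<close>)
  qed (use assms in \<open>auto simp: hc_indep_def T_def dest: sympD irreflpD\<close>)
  moreover have "hc_indep adj (S - {u}) \<inter> insert u ` hc_indep adj T = {}"
    by (auto simp: hc_indep_def)
  ultimately have "hc_Z adj w S = hc_Z adj w (S - {u}) + (\<Sum>I\<in>insert u ` hc_indep adj T. prod w I)"
    unfolding hc_Z_def using fin by (simp add: sum.union_disjoint T_def Diff_subset)
  also have "(\<Sum>I\<in>insert u ` hc_indep adj T. prod w I) = (\<Sum>I\<in>hc_indep adj T. w u * prod w I)"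
  proof (subst sum.reindex)
    show "inj_on (insert u) (hc_indep adj T)"
      using uT by (auto intro!: inj_onI simp: insert_ident)
  qed (use uT in \<open>auto intro!: sum.cong\<close>)
  finally show ?thesis by (simp add: hc_Z_def T_def sum_distrib_left)
qed

text \<open>Induction over proper subsets, because the deletion identity refers to two smaller
  vertex sets. The factors over the non-neighbours \<open>T\<close> of \<open>u\<close> are pulled
  out, and \<open>vertex_deletion_inequality\<close> settles \<open>u\<close> and its neighbours
  \<open>K\<close>.\<close>

theorem hc_Z_lower_bound:
  fixes w :: "'b \<Rightarrow> real"
  assumes "finite S" "symp adj" "irreflp adj" and "\<And>v. v \<in> S \<Longrightarrow> w v \<ge> 0"
  shows "(\<Prod>v\<in>S. hc_factor (hc_deg adj S v) (w v)) \<le> hc_Z adj w S"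
  using assms(1,4)
proof (induction S rule: finite_psubset_induct)
  case (psubset S)
  show ?case
  proof (cases "S = {}")
    case True
    then show ?thesis by (simp add: hc_Z_def hc_indep_def cong: conj_cong)
  next
    case False
    define d where "d = hc_deg adj S"
    have "Max (d ` S) \<in> d ` S" using psubset False by (intro Max_in) auto
    then obtain u where u: "u \<in> S" and "Max (d ` S) = d u" by auto
    then have u_max: "d v \<le> d u" if "v \<in> S" for v
      using that psubset.hyps(1) by (metis Max_ge finite_imageI imageI)
    define K where "K = {x \<in> S. adj u x}"
    define T where "T = S - insert u K"
    have fin: "finite K" "finite T" using psubset by (auto simp: K_def T_def)
    have uK: "u \<notin> K" "K \<subseteq> S" "S - {u} = T \<union> K" "T \<inter> K = {}" "u \<notin> T"
      using u irreflpD[OF assms(3)] by (auto simp: K_def T_def)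
    have S_eq: "S = insert u (T \<union> K)" using uK u by auto
    have dK: "d u = card K" by (simp add: d_def hc_deg_def K_def)
    have w: "\<And>v. v \<in> S \<Longrightarrow> w v \<ge> 0" by (rule psubset.prems)
    let ?h = "\<lambda>v. hc_factor (d v) (w v)"
    have pos: "?h v > 0" if "v \<in> S" for v using w that by (simp add: hc_factor_pos)
    \<comment> \<open>Deleting \<open>u\<close> lowers the degree of each neighbour by exactly one
      and leaves the degrees in \<open>T\<close> unchanged.\<close>
    have "(\<Prod>v\<in>T. ?h v) * (\<Prod>v\<in>K. hc_factor (d v - 1) (w v)) = (\<Prod>v\<in>S - {u}. hc_factor (hc_deg adj (S - {u}) v) (w v))"
    proof -
      have "hc_deg adj (S - {u}) v = d v" if "v \<in> T" for v
        using that assms(2) unfolding d_def hc_deg_def T_def K_def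
        by (intro arg_cong[where f = card]) (auto dest: sympD)
      moreover have "hc_deg adj (S - {u}) v = d v - 1" if "v \<in> K" for v
      proof -
        have "{x \<in> S - {u}. adj v x} = {x \<in> S. adj v x} - {u}" "u \<in> {x \<in> S. adj v x}"
          using that u sympD[OF assms(2)] by (auto simp: K_def)
        then show ?thesis by (simp add: hc_deg_def d_def card_Diff_singleton)
      qed
      ultimately show ?thesis using fin uK by (simp add: prod.union_disjoint)
    qed
    also have "\<dots> \<le> hc_Z adj w (S - {u})"
      using u w by (intro psubset.IH) auto
    finally have 1: "(\<Prod>v\<in>T. ?h v) * (\<Prod>v\<in>K. hc_factor (d v - 1) (w v)) \<le> hc_Z adj w (S - {u})" .
    \<comment> \<open>Degrees inside \<open>T\<close> may drop by more, but a lower degree only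
      increases the factor.\<close>
    have "(\<Prod>v\<in>T. ?h v) \<le> (\<Prod>v\<in>T. hc_factor (hc_deg adj T v) (w v))"
    proof (intro prod_mono conjI hc_factor_antimono)
      fix v assume v: "v \<in> T"
      then have "v \<in> S" by (simp add: T_def)
      then show "w v \<ge> 0" "?h v \<ge> 0" using w pos by (auto intro: less_imp_le)
      show "hc_deg adj T v \<le> d v"
        unfolding hc_deg_def d_def using psubset by (intro card_mono) (auto simp: T_def)
    qed
    also have "\<dots> \<le> hc_Z adj w T"
      using u w by (intro psubset.IH) (auto simp: T_def)
    finally have 2: "(\<Prod>v\<in>T. ?h v) \<le> hc_Z adj w T" .
    have 3: "?h u * (\<Prod>v\<in>K. ?h v) \<le> (\<Prod>v\<in>K. hc_factor (d v - 1) (w v)) + w u"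
      unfolding dK
    proof (rule vertex_deletion_inequality)
      fix v assume v: "v \<in> K"
      then have "v \<in> S" using uK by auto
      then show "w v \<ge> 0" using w by auto
      \<comment> \<open>The neighbour \<open>u\<close> forces \<open>d v\<close> to be positive, so
        the truncated subtraction \<open>d v - 1\<close> is exact.\<close>
      have "u \<in> {x \<in> S. adj v x}" using v u sympD[OF assms(2)] by (auto simp: K_def)
      then have "d v > 0" using psubset by (auto simp: d_def hc_deg_def card_gt_0_iff)
      then show "1 \<le> d v \<and> d v \<le> card K" using u_max[OF \<open>v \<in> S\<close>] dK by simp
    qed (use fin w u in auto)
    have T0: "(\<Prod>v\<in>T. ?h v) > 0" using pos by (intro prod_pos) (auto simp: T_def)
    have "(\<Prod>v\<in>S. ?h v) = (\<Prod>v\<in>T. ?h v) * (?h u * (\<Prod>v\<in>K. ?h v))"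
      by (subst S_eq) (use fin uK in \<open>simp add: prod.union_disjoint\<close>)
    also have "\<dots> \<le> (\<Prod>v\<in>T. ?h v) * ((\<Prod>v\<in>K. hc_factor (d v - 1) (w v)) + w u)"
      using 3 T0 by (intro mult_left_mono) auto
    also have "\<dots> \<le> hc_Z adj w (S - {u}) + w u * hc_Z adj w T"
      using 1 mult_left_mono[OF 2 w[OF u]] by (simp add: algebra_simps)
    also have "\<dots> = hc_Z adj w S"
      using hc_Z_vertex_deletion[OF psubset.hyps(1) u assms(2,3)] by (simp add: T_def K_def)
    finally show ?thesis by (simp add: d_def)
  qed
qed

section \<open>From tuples of sets to independent sets of a product graph\<close>

text \<open>Each edge at \<open>v\<close> has exactly one other endpoint. This links
  \<open>vdegree\<close>, which counts edges, to \<open>hc_deg\<close>, which counts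
  vertices.\<close>

lemma vdegree_eq_card_neighbours:
  assumes "simple_graph G"
  shows "vdegree G v = card {u \<in> verts G. {v, u} \<in> edges G}"
proof -
  have "\<exists>u. u \<in> verts G \<and> e = {v, u}" if "e \<in> edges G" "v \<in> e" for e
  proof -
    have "e \<in> [verts G]\<^bsup>2\<^esup>" using that assms by (auto simp: simple_graph_def)
    then obtain x y where "e = {x, y}" "x \<in> verts G" "y \<in> verts G" by (rule nsets2_E)
    then show ?thesis using that(2) by (cases "v = x") (auto simp: insert_commute)
  qed
  then have "bij_betw (\<lambda>u. {v, u}) {u \<in> verts G. {v, u} \<in> edges G} {e \<in> edges G. v \<in> e}"
    by (auto simp: bij_betw_def inj_on_def doubleton_eq_iff)
  then show ?thesis by (simp add: vdegree_def bij_betw_same_card)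
qed

lemma doubleton_edge_neq: "simple_graph G \<Longrightarrow> {v, w} \<in> edges G \<Longrightarrow> v \<noteq> w"
  by (auto simp: simple_graph_def nsets_def)

text \<open>On \<open>{1..q} \<times> verts G\<close> this is the Cartesian product of the complete
  graph on \<open>q\<close> vertices with \<open>G\<close>: one copy of \<open>G\<close> per layer,
  and all copies of a vertex pairwise adjacent.\<close>

definition layered_adj :: "'a graph \<Rightarrow> nat \<times> 'a \<Rightarrow> nat \<times> 'a \<Rightarrow> bool" where
  "layered_adj G x y \<longleftrightarrow> (snd x = snd y \<and> fst x \<noteq> fst y) \<or> (fst x = fst y \<and> {snd x, snd y} \<in> edges G)"

lemma symp_layered_adj: "symp (layered_adj G)"
  by (auto simp: symp_def layered_adj_def insert_commute)

lemma irreflp_layered_adj: "simple_graph G \<Longrightarrow> irreflp (layered_adj G)"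
  by (auto simp: irreflp_def layered_adj_def simple_graph_def nsets_def)

text \<open>The neighbours of a copy of \<open>v\<close> are those in its own layer and the
  \<open>q - 1\<close> other copies of \<open>v\<close>.\<close>

lemma hc_deg_layered_adj:
  assumes "simple_graph G" "i \<in> {1..q}" "v \<in> verts G"
  shows "hc_deg (layered_adj G) ({1..q} \<times> verts G) (i, v) = vdegree G v + (q - 1)"
proof -
  have "{x \<in> {1..q} \<times> verts G. layered_adj G (i, v) x}
      = Pair i ` {u \<in> verts G. {v, u} \<in> edges G} \<union> (\<lambda>j. (j, v)) ` ({1..q} - {i})"
    using assms by (auto simp: layered_adj_def)
  moreover have "card (Pair i ` {u \<in> verts G. {v, u} \<in> edges G} \<union> (\<lambda>j. (j, v)) ` ({1..q} - {i}))
      = card {u \<in> verts G. {v, u} \<in> edges G} + (q - 1)"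
  proof (subst card_Un_disjoint)
    show "finite (Pair i ` {u \<in> verts G. {v, u} \<in> edges G})"
      using assms by (simp add: simple_graph_def)
    have "card ((\<lambda>j. (j, v)) ` ({1..q} - {i})) = q - 1"
      using assms by (subst card_image) (auto simp: inj_on_def)
    then show "card (Pair i ` {u \<in> verts G. {v, u} \<in> edges G}) + card ((\<lambda>j. (j, v)) ` ({1..q} - {i}))
        = card {u \<in> verts G. {v, u} \<in> edges G} + (q - 1)"
      by (simp add: card_image inj_on_def)
  qed auto
  ultimately show ?thesis using assms by (simp add: hc_deg_def vdegree_eq_card_neighbours)
qed

lemma finite_independent_sets: "finite (verts G) \<Longrightarrow> finite (independent_sets G)"
  by (rule finite_subset[of _ "Pow (verts G)"]) (auto simp: independent_sets_def)

text \<open>A tuple \<open>I\<close> corresponds to the set \<open>Sigma {1..q} I\<close>. Edges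
  within a layer express that each \<open>I i\<close> is independent, and edges between copies of a
  vertex express disjointness.\<close>

lemma Zq_eq_hc_Z:
  assumes "simple_graph G"
  shows "Zq q G lam = hc_Z (layered_adj G) (\<lambda>(i, v). lam i v) ({1..q} \<times> verts G)"
  unfolding Zq_def hc_Z_def
proof (rule sum.reindex_bij_witness[where i = "\<lambda>J. \<lambda>i\<in>{1..q}. {v. (i, v) \<in> J}" and j = "Sigma {1..q}"])
  fix I assume I: "I \<in> independent_tuples q G"
  then have sub: "I i \<subseteq> verts G" if "i \<in> {1..q}" for i
    using that by (auto simp: independent_tuples_def independent_sets_def PiE_iff)
  have ext: "I \<in> extensional {1..q}" using I by (simp add: independent_tuples_def PiE_def)
  then show "(\<lambda>i\<in>{1..q}. {v. (i, v) \<in> Sigma {1..q} I}) = I"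
    by (auto simp: fun_eq_iff extensional_def)
  have nonadj: "{v, w} \<notin> edges G" if "i \<in> {1..q}" "v \<in> I i" "w \<in> I i" for i v w
    using I that doubleton_edge_neq[OF assms, of v w]
    by (auto simp: independent_tuples_def independent_sets_def PiE_iff indep_def)
  have "disjoint_family_on I {1..q}" using I by (simp add: independent_tuples_def)
  then have "i = j" if "i \<in> {1..q}" "j \<in> {1..q}" "v \<in> I i" "v \<in> I j" for i j v
    using disjoint_family_onD[of I "{1..q}" i j] that by blast
  then show "Sigma {1..q} I \<in> hc_indep (layered_adj G) ({1..q} \<times> verts G)"
    using sub nonadj by (fastforce simp: hc_indep_def layered_adj_def)
  have "finite (I i)" if "i \<in> {1..q}" for i
    using sub[OF that] assms by (auto simp: simple_graph_def intro: finite_subset)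
  then show "(\<Prod>(i, v)\<in>Sigma {1..q} I. lam i v) = (\<Prod>i=1..q. \<Prod>v\<in>I i. lam i v)"
    by (simp add: prod.Sigma)
next
  fix J assume J: "J \<in> hc_indep (layered_adj G) ({1..q} \<times> verts G)"
  then show "Sigma {1..q} (\<lambda>i\<in>{1..q}. {v. (i, v) \<in> J}) = J"
    by (auto simp: hc_indep_def)
  have nonadj: "\<not> layered_adj G a b" if "a \<in> J" "b \<in> J" for a b
    using J that by (auto simp: hc_indep_def)
  have "{v, w} \<notin> edges G" if "(i, v) \<in> J" "(i, w) \<in> J" for i v w
    using nonadj[OF that] by (simp add: layered_adj_def)
  moreover have "v \<in> verts G" if "(i, v) \<in> J" for i v
    using J that by (auto simp: hc_indep_def)
  ultimately have "{v. (i, v) \<in> J} \<in> independent_sets G" for i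
    by (auto simp: independent_sets_def indep_def)
  moreover have "i = j" if "(i, v) \<in> J" "(j, v) \<in> J" for i j v
    using nonadj[OF that] by (simp add: layered_adj_def)
  ultimately show "(\<lambda>i\<in>{1..q}. {v. (i, v) \<in> J}) \<in> independent_tuples q G"
    by (auto simp: independent_tuples_def disjoint_family_on_def)
qed

theorem Zq_lower_bound:
  assumes "simple_graph G" "\<And>i v. i \<in> {1..q} \<Longrightarrow> v \<in> verts G \<Longrightarrow> lam i v \<ge> 0"
  shows "(\<Prod>v\<in>verts G. \<Prod>i=1..q. hc_factor (vdegree G v + (q - 1)) (lam i v)) \<le> Zq q G lam"
proof -
  have fin: "finite (verts G)" using assms by (simp add: simple_graph_def)
  have "(\<Prod>v\<in>verts G. \<Prod>i=1..q. hc_factor (vdegree G v + (q - 1)) (lam i v))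
      = (\<Prod>(i, v)\<in>{1..q} \<times> verts G. hc_factor (vdegree G v + (q - 1)) (lam i v))"
    by (subst prod.swap) (rule prod.cartesian_product)
  also have "\<dots> = (\<Prod>x\<in>{1..q} \<times> verts G.
      hc_factor (hc_deg (layered_adj G) ({1..q} \<times> verts G) x) (case x of (i, v) \<Rightarrow> lam i v))"
    using assms(1) by (intro prod.cong refl) (auto simp: hc_deg_layered_adj simp del: One_nat_def)
  also have "\<dots> \<le> Zq q G lam"
    unfolding Zq_eq_hc_Z[OF assms(1)] using assms fin
    by (intro hc_Z_lower_bound symp_layered_adj irreflp_layered_adj) auto
  finally show ?thesis .
qed

section \<open>Upper bounds for sums over disjoint tuples\<close>

lemma independent_tuples_subset: "independent_tuples q G \<subseteq> {1..q} \<rightarrow>\<^sub>E independent_sets G"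
  by (auto simp: independent_tuples_def)

text \<open>Dropping disjointness only adds nonnegative terms, and the sum over all tuples
  factorizes.\<close>

lemma Zq_scalar_le_prod_Z:
  assumes "finite (verts G)" "\<And>i. i \<in> {1..q} \<Longrightarrow> x i \<ge> 0"
  shows "Zq_scalar q G x \<le> (\<Prod>i=1..q. Z G (x i))"
proof -
  have fin: "finite (independent_sets G)" using assms(1) by (rule finite_independent_sets)
  then have "Zq_scalar q G x \<le> (\<Sum>I\<in>{1..q} \<rightarrow>\<^sub>E independent_sets G. \<Prod>i=1..q. x i ^ card (I i))"
    unfolding Zq_scalar_def using assms
    by (intro sum_mono2 independent_tuples_subset finite_PiE prod_nonneg) auto
  also have "\<dots> = (\<Prod>i=1..q. Z G (x i))"
    unfolding Z_def using fin by (intro prod_sum_PiE[symmetric]) auto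
  finally show ?thesis .
qed

(* The tuples that are subtracted consist of two equal singletons and otherwise empty sets. *)
lemma Zq_scalar_le_power_Z:
  assumes "finite (verts G)" "x \<ge> 0"
  shows "Zq_scalar q G (\<lambda>_. x) \<le> Z G x ^ q - real (q choose 2) * real (card (verts G)) * x\<^sup>2"
proof -
  have fin: "finite (independent_sets G)" using assms(1) by (rule finite_independent_sets)
  let ?P = "{1..q} \<rightarrow>\<^sub>E independent_sets G"
  let ?w = "\<lambda>I. \<Prod>i=1..q. x ^ card (I i :: 'a set)"
  \<comment> \<open>A pair \<open>(e, v)\<close> encodes the tuple \<open>f (e, v)\<close> with
    \<open>{v}\<close> at the two positions in \<open>e\<close> and the empty set elsewhere. Its
    weight is \<open>x\<^sup>2\<close>, and it violates disjointness.\<close>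
  define A where "A = {e. e \<subseteq> {1..q} \<and> card e = 2} \<times> verts G"
  define f where "f = (\<lambda>(e, v). \<lambda>i\<in>{1..q}. if i \<in> e then {v} else {} :: 'a set)"
  have e2: "\<exists>i j. e = {i, j} \<and> i \<noteq> j \<and> i \<in> {1..q} \<and> j \<in> {1..q}" if "(e, v) \<in> A" for e v
  proof -
    have "card e = 2" using that by (simp add: A_def)
    then obtain i j where "e = {i, j}" "i \<noteq> j" unfolding card_2_iff by blast
    moreover have "e \<subseteq> {1..q}" using that by (simp add: A_def)
    ultimately show ?thesis by blast
  qed
  have "inj_on f A"
  proof (rule inj_onI, clarify)
    fix e v e' v' assume 1: "(e, v) \<in> A" "(e', v') \<in> A" and eq: "f (e, v) = f (e', v')"
    have sub: "e \<subseteq> {1..q}" "e' \<subseteq> {1..q}" using 1 by (auto simp: A_def)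
    have ite: "(if i \<in> e then {v} else {}) = (if i \<in> e' then {v'} else {})" if "i \<in> {1..q}" for i
      using fun_cong[OF eq, of i] that by (simp add: f_def)
    have "i \<in> e \<longleftrightarrow> i \<in> e'" if "i \<in> {1..q}" for i
      using ite[OF that] by (simp split: if_splits)
    then have "e = e'" using sub by blast
    moreover obtain i where "i \<in> e" "i \<in> {1..q}" using e2[OF 1(1)] by auto
    ultimately show "e = e' \<and> v = v'" using ite[of i] by simp
  qed
  moreover have "?w (f z) = x\<^sup>2" if "z \<in> A" for z
  proof -
    obtain e v where z: "z = (e, v)" "e \<subseteq> {1..q}" "card e = 2" using \<open>z \<in> A\<close> by (auto simp: A_def)
    have "?w (f z) = (\<Prod>i\<in>{1..q}. if i \<in> e then x else 1)"
      by (intro prod.cong) (auto simp: f_def z)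
    also have "\<dots> = (\<Prod>i\<in>e. x)"
      using z by (simp add: prod.If_cases Int_absorb1)
    finally show ?thesis using z by simp
  qed
  ultimately have wA: "sum ?w (f ` A) = real (q choose 2) * real (card (verts G)) * x\<^sup>2"
    by (simp add: sum.reindex A_def card_cartesian_product n_subsets)
  have "f ` A \<subseteq> ?P - independent_tuples q G"
  proof clarify
    fix e v assume ev: "(e, v) \<in> A"
    have "v \<in> verts G" using ev by (simp add: A_def)
    then have "{v} \<in> independent_sets G" "{} \<in> independent_sets G"
      by (auto simp: independent_sets_def indep_def)
    then have "f (e, v) \<in> ?P" by (auto simp: f_def)
    moreover obtain i j where ij: "e = {i, j}" "i \<noteq> j" "i \<in> {1..q}" "j \<in> {1..q}"
      using e2[OF ev] by blast
    have "f (e, v) i = {v}" "f (e, v) j = {v}" using ij by (simp_all add: f_def)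
    then have "\<not> disjoint_family_on (f (e, v)) {1..q}"
      using ij disjoint_family_onD[of "f (e, v)" "{1..q}" i j] by auto
    ultimately show "f (e, v) \<in> ?P - independent_tuples q G"
      by (simp add: independent_tuples_def)
  qed
  then have "sum ?w (f ` A) + Zq_scalar q G (\<lambda>_. x) \<le> sum ?w (?P - independent_tuples q G) + Zq_scalar q G (\<lambda>_. x)"
    using fin assms by (intro add_right_mono sum_mono2 prod_nonneg) (auto intro!: finite_PiE)
  also have "\<dots> = sum ?w ?P"
    unfolding Zq_scalar_def using fin
    by (intro sum.subset_diff[symmetric] independent_tuples_subset finite_PiE) auto
  also have "\<dots> = (\<Prod>i=1..q. Z G x)"
    unfolding Z_def using fin by (intro prod_sum_PiE[symmetric]) auto
  finally show ?thesis unfolding wA by simp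
qed

section \<open>Comparison of the factors of a single vertex\<close>

lemma one_plus_sum_le_prod:
  fixes f :: "'b \<Rightarrow> real"
  assumes "\<And>i. i \<in> A \<Longrightarrow> f i \<ge> 0"
  shows "1 + sum f A \<le> (\<Prod>i\<in>A. 1 + f i)"
  using assms
proof (induction A rule: infinite_finite_induct)
  case (insert a A)
  have "0 \<le> f a * sum f A" using insert by (intro mult_nonneg_nonneg sum_nonneg) auto
  then have "1 + sum f (insert a A) \<le> (1 + f a) * (1 + sum f A)"
    using insert by (simp add: algebra_simps)
  also have "\<dots> \<le> (1 + f a) * (\<Prod>i\<in>A. 1 + f i)"
    using insert by (intro mult_left_mono) auto
  finally show ?case using insert by simp
qed auto

text \<open>The difference of the sides vanishes at 0 and has derivative
  \<open>s - s / (1 + s)\<^sup>2\<close>, which is nonnegative. With \<open>t = k * x\<close> this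
  is the sign condition for a derivative in \<open>k\<close> in the next lemma.\<close>

lemma ln_one_plus_le_rational:
  fixes t :: real
  assumes "t \<ge> 0"
  shows "ln (1 + t) \<le> t / (1 + t) + t\<^sup>2 / 2"
proof -
  define g where "g s = s / (1 + s) + s\<^sup>2 / 2 - ln (1 + s)" for s :: real
  have "\<exists>y. DERIV g s :> y \<and> y \<ge> 0" if s: "0 \<le> s" for s
  proof -
    have "DERIV g s :> s - s / (1 + s)\<^sup>2"
    proof (rule DERIV_cong)
      show "DERIV g s :> (1 + s - s) / ((1 + s) * (1 + s)) + s - 1 / (1 + s)"
        unfolding g_def using s by (auto intro!: derivative_eq_intros)
      show "(1 + s - s) / ((1 + s) * (1 + s)) + s - 1 / (1 + s) = s - s / (1 + s)\<^sup>2"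
        using s by (simp add: divide_simps power2_eq_square)
    qed
    moreover have "s / (1 + s)\<^sup>2 \<le> s"
      using s by (simp add: divide_le_eq mult_le_cancel_left1 one_le_power)
    ultimately show ?thesis by force
  qed
  then have "g 0 \<le> g t" by (rule DERIV_nonneg_imp_nondecreasing[OF assms])
  then show ?thesis by (simp add: g_def)
qed

(* The term k * x^2 / 2 cancels the second-order decay in k of ln (1 + k * x) / k.  It makes the
   second-order terms match when the factor of K_(d+q) is compared with that of K_(d+1). *)
lemma ln_one_plus_div_mono_corrected:
  fixes x n m :: real
  assumes "0 < n" "n \<le> m" "x \<ge> 0"
  shows "ln (1 + n * x) / n + n * x\<^sup>2 / 2 \<le> ln (1 + m * x) / m + m * x\<^sup>2 / 2"
proof (rule DERIV_nonneg_imp_nondecreasing[OF assms(2)])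
  fix k assume k: "n \<le> k" "k \<le> m"
  have kx: "1 + k * x > 0" "k > 0" using assms k by (auto intro!: add_pos_nonneg)
  have der: "DERIV (\<lambda>k. ln (1 + k * x) / k + k * x\<^sup>2 / 2) k :>
      (x / (1 + k * x) * k - ln (1 + k * x)) / k\<^sup>2 + x\<^sup>2 / 2"
    using kx by (auto intro!: derivative_eq_intros simp: power2_eq_square)
  have eq: "(x / (1 + k * x) * k - ln (1 + k * x)) / k\<^sup>2 + x\<^sup>2 / 2
      = (k * x / (1 + k * x) + (k * x)\<^sup>2 / 2 - ln (1 + k * x)) / k\<^sup>2"
    using kx by (simp add: add_divide_distrib diff_divide_distrib power_mult_distrib mult.commute)
  have nonneg: "(k * x / (1 + k * x) + (k * x)\<^sup>2 / 2 - ln (1 + k * x)) / k\<^sup>2 \<ge> 0"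
    using ln_one_plus_le_rational[of "k * x"] kx assms by (intro divide_nonneg_nonneg) auto
  show "\<exists>y. DERIV (\<lambda>k. ln (1 + k * x) / k + k * x\<^sup>2 / 2) k :> y \<and> 0 \<le> y"
    using der nonneg unfolding eq by blast
qed

lemma hc_factor_eq_exp:
  assumes "x \<ge> 0"
  shows "hc_factor d x = exp (ln (1 + (real d + 1) * x) / (real d + 1))"
proof -
  have "1 + (real d + 1) * x > 0" using assms by (simp add: add_pos_nonneg)
  then show ?thesis by (simp add: hc_factor_def powr_def)
qed

lemma Zq_scalar_nonneg: "(\<And>i. i \<in> {1..q} \<Longrightarrow> x i \<ge> 0) \<Longrightarrow> Zq_scalar q G x \<ge> 0"
  unfolding Zq_scalar_def by (intro sum_nonneg prod_nonneg) auto

text \<open>Let \<open>s\<close> be the sum of the fugacities and \<open>m = d + q\<close>. The left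
  side is at most \<open>exp s\<close>, hence at most \<open>1 + s + s\<^sup>2\<close>, and the
  product on the right is at least \<open>1 + s - m * s\<^sup>2\<close>. The gap is
  \<open>(m + 1) * s\<^sup>2\<close>.\<close>

lemma Zq_scalar_root_le_general:
  fixes d q :: nat
  assumes q: "q \<ge> 1" and x: "\<And>i. i \<in> {1..q} \<Longrightarrow> x i \<ge> 0"
    and small: "(real d + real q) * (\<Sum>i=1..q. x i) \<le> 1"
  shows "Zq_scalar q (complete_graph (d + 1)) x powr (1 / real (d + 1))
    \<le> (\<Prod>i=1..q. hc_factor (d + (q - 1)) (x i)) + (real d + real q + 1) * (\<Sum>i=1..q. x i)\<^sup>2"
proof -
  define s where "s = (\<Sum>i=1..q. x i)"
  define m where "m = real d + real q"
  have s: "s \<ge> 0" unfolding s_def using x by (intro sum_nonneg) auto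
  have m: "m \<ge> 1" using q by (simp add: m_def)
  have m_eq: "real (d + (q - 1)) + 1 = m" using q by (simp add: m_def of_nat_diff)
  have factor: "hc_factor (d + (q - 1)) t = (1 + m * t) powr (1 / m)" for t
    by (simp only: hc_factor_def m_eq)
  have ms: "0 \<le> m * s" "m * s \<le> 1" "s \<le> 1"
    using small s m mult_right_mono[OF m s] by (auto simp: m_def s_def)
  have "Zq_scalar q (complete_graph (d + 1)) x \<le> (\<Prod>i=1..q. Z (complete_graph (d + 1)) (x i))"
    using x by (intro Zq_scalar_le_prod_Z) (auto simp: complete_graph_def)
  also have "\<dots> \<le> (\<Prod>i=1..q. exp (real (d + 1) * x i))"
    using x by (intro prod_mono conjI) (auto simp: Z_complete_graph intro!: add_nonneg_nonneg exp_ge_add_one_self simp del: of_nat_add of_nat_Suc)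
  also have "\<dots> = exp (real (d + 1) * s)"
    by (simp only: s_def sum_distrib_left exp_sum finite_atLeastAtMost)
  finally have "Zq_scalar q (complete_graph (d + 1)) x powr (1 / real (d + 1)) \<le> exp (real (d + 1) * s) powr (1 / real (d + 1))"
    using x by (intro powr_mono2 Zq_scalar_nonneg) auto
  also have "\<dots> = exp s" by (simp add: powr_def)
  also have "\<dots> \<le> 1 + s + s\<^sup>2" using exp_bound[OF s ms(3)] .
  finally have 1: "Zq_scalar q (complete_graph (d + 1)) x powr (1 / real (d + 1)) \<le> 1 + s + s\<^sup>2" .
  \<comment> \<open>The lower bound \<open>t - t\<^sup>2\<close> for \<open>ln (1 + t)\<close> at
    \<open>t = m * s\<close>, which is at most 1 by \<open>small\<close>.\<close>
  have "s - m * s\<^sup>2 = (m * s - (m * s)\<^sup>2) / m"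
    using m by (simp add: power2_eq_square field_simps)
  also have "\<dots> \<le> ln (1 + m * s) / m"
    using ms m by (intro divide_right_mono ln_one_plus_pos_lower_bound) auto
  finally have "1 + (s - m * s\<^sup>2) \<le> exp (ln (1 + m * s) / m)"
    using exp_ge_add_one_self order.trans by (meson add_left_mono)
  also have "\<dots> = (1 + (\<Sum>i=1..q. m * x i)) powr (1 / m)"
    using ms by (simp add: powr_def s_def sum_distrib_left add_pos_nonneg less_imp_neq[symmetric])
  also have "\<dots> \<le> (\<Prod>i=1..q. 1 + m * x i) powr (1 / m)"
    using x m by (intro powr_mono2 one_plus_sum_le_prod) (auto intro!: add_nonneg_nonneg sum_nonneg)
  also have "\<dots> = (\<Prod>i=1..q. hc_factor (d + (q - 1)) (x i))"
    by (simp only: prod_powr_distrib factor)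
  finally show ?thesis using 1 by (simp add: s_def m_def algebra_simps)
qed

text \<open>The second-order terms of the logarithms cancel. With \<open>n = d + 1\<close>,
  \<open>m = d + q\<close> and \<open>c = q choose 2\<close>, the removed tuples gain about
  \<open>c * x\<^sup>2\<close>, while replacing \<open>n\<close> by \<open>m\<close> costs
  \<open>q * (m - n) * x\<^sup>2 / 2\<close>, which is the same amount. The remaining error has the
  extra factor \<open>(d + 1) * x\<close>.\<close>

lemma Zq_scalar_root_le_uniform:
  fixes d q :: nat and x :: real
  assumes q: "q \<ge> 1" and x: "x \<ge> 0" and small: "(real d + 1) * x \<le> 1"
  defines "K \<equiv> real (q choose 2) * real q"
  shows "Zq_scalar q (complete_graph (d + 1)) (\<lambda>_. x) powr (1 / real (d + 1))
    \<le> (\<Prod>i=1..q. hc_factor (d + (q - 1)) x) + exp (real q + K) * K * ((real d + 1) * x) * x\<^sup>2"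
proof -
  define n where "n = real d + 1"
  define m where "m = real d + real q"
  define y where "y = n * x"
  define c where "c = real (q choose 2)"
  \<comment> \<open>The subtracted term relative to \<open>(1 + y) ^ q\<close>; bounding
    \<open>1 - z\<close> by \<open>exp (- z)\<close> moves the correction into the exponent.\<close>
  define z where "z = c * n * x\<^sup>2 / (1 + y) ^ q"
  define P where "P = (\<Prod>i=1..q. hc_factor (d + (q - 1)) x)"
  have n: "n \<ge> 1" and nm: "n \<le> m" and m_eq: "real (d + (q - 1)) + 1 = m"
    using q by (auto simp: n_def m_def of_nat_diff)
  have factor: "hc_factor (d + (q - 1)) x = exp (ln (1 + m * x) / m)"
    using x by (simp only: hc_factor_eq_exp m_eq)
  have y: "0 \<le> y" "y \<le> 1" "x \<le> y" using x small n mult_right_mono[OF n x] by (auto simp: y_def n_def)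
  have "even (q * (q - 1))" by auto
  then have "2 * (q choose 2) = q * (q - 1)" by (simp only: choose_two dvd_mult_div_cancel)
  then have "2 * c = real q * (real q - 1)"
    unfolding c_def using q by (metis of_nat_mult of_nat_numeral of_nat_1 of_nat_diff)
  then have c: "c \<ge> 0" "c = real q * (m - n) / 2"
    by (auto simp: c_def m_def n_def)
  have K: "K = c * real q" "K \<ge> 0" by (auto simp: K_def c_def)
  have fin: "finite (verts (complete_graph (d + 1)))" and card: "card (verts (complete_graph (d + 1))) = d + 1"
    by (auto simp: complete_graph_def)
  have "Zq_scalar q (complete_graph (d + 1)) (\<lambda>_. x) \<le> (1 + y) ^ q - c * n * x\<^sup>2"
    using Zq_scalar_le_power_Z[OF fin x] unfolding card
    by (simp add: Z_complete_graph y_def n_def c_def algebra_simps)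
  also have "\<dots> = (1 + y) ^ q * (1 + (- z))"
    using y by (simp add: z_def right_diff_distrib)
  also have "\<dots> \<le> (1 + y) ^ q * exp (- z)"
    using y by (intro mult_left_mono exp_ge_add_one_self) auto
  also have "\<dots> = exp (real q * ln (1 + y) - z)"
    using y by (simp add: exp_diff exp_minus exp_of_nat_mult divide_inverse)
  finally have "Zq_scalar q (complete_graph (d + 1)) (\<lambda>_. x) powr (1 / n) \<le> exp (real q * ln (1 + y) - z) powr (1 / n)"
    using x n by (intro powr_mono2 Zq_scalar_nonneg) auto
  also have "\<dots> = exp (real q * (ln (1 + y) / n) - z / n)"
    by (simp add: powr_def diff_divide_distrib)
  also have "\<dots> \<le> exp (real q * (ln (1 + m * x) / m) + K * y * x\<^sup>2)"
  proof (subst exp_le_cancel_iff)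
    \<comment> \<open>Bernoulli's inequality for \<open>1 / (1 + y)\<close> shows that
      \<open>z / n\<close> falls short of \<open>c * x\<^sup>2\<close> by at most
      \<open>K * y * x\<^sup>2\<close>.\<close>
    have "1 - real q * y \<le> 1 + real q * (- (y / (1 + y)))"
      using y q by (simp add: divide_le_eq algebra_simps)
    also have "\<dots> \<le> (1 + (- (y / (1 + y)))) ^ q"
      using y by (intro Bernoulli_inequality) (simp add: divide_le_eq)
    also have "1 + (- (y / (1 + y))) = 1 / (1 + y)"
      using y by (simp add: field_simps)
    finally have "1 - real q * y \<le> 1 / (1 + y) ^ q" by (simp add: power_one_over)
    then have "c * x\<^sup>2 * (1 - real q * y) \<le> c * x\<^sup>2 * (1 / (1 + y) ^ q)"
      using c by (intro mult_left_mono) auto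
    also have "\<dots> = z / n" using n by (simp add: z_def)
    finally have 1: "c * x\<^sup>2 - K * y * x\<^sup>2 \<le> z / n" by (simp add: K algebra_simps)
    have "ln (1 + y) / n + n * x\<^sup>2 / 2 \<le> ln (1 + m * x) / m + m * x\<^sup>2 / 2"
      unfolding y_def using n nm x by (intro ln_one_plus_div_mono_corrected) auto
    then have "ln (1 + y) / n - (m - n) * x\<^sup>2 / 2 \<le> ln (1 + m * x) / m"
      by (simp add: left_diff_distrib diff_divide_distrib)
    then have "real q * (ln (1 + y) / n - (m - n) * x\<^sup>2 / 2) \<le> real q * (ln (1 + m * x) / m)"
      by (intro mult_left_mono) auto
    moreover have "real q * (ln (1 + y) / n - (m - n) * x\<^sup>2 / 2) = real q * (ln (1 + y) / n) - c * x\<^sup>2"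
      by (simp add: c(2) algebra_simps)
    ultimately show "real q * (ln (1 + y) / n) - z / n \<le> real q * (ln (1 + m * x) / m) + K * y * x\<^sup>2"
      using 1 by linarith
  qed
  also have "\<dots> = P * exp (K * y * x\<^sup>2)"
    by (simp only: P_def factor exp_add exp_of_nat_mult prod_constant card_atLeastAtMost) simp
  finally have main: "Zq_scalar q (complete_graph (d + 1)) (\<lambda>_. x) powr (1 / n) \<le> P * exp (K * y * x\<^sup>2)" .
  have P0: "P \<ge> 0" unfolding P_def using x by (intro prod_nonneg) (auto intro: less_imp_le hc_factor_pos)
  have "P = exp (real q * (ln (1 + m * x) / m))"
    by (simp only: P_def factor exp_of_nat_mult prod_constant card_atLeastAtMost) simp
  also have "\<dots> \<le> exp (real q * 1)"
  proof -
    have "ln (1 + m * x) \<le> m * x" using n nm x by (intro ln_add_one_self_le_self) auto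
    then have "ln (1 + m * x) / m \<le> x" using n nm by (simp add: divide_le_eq mult.commute)
    then have "ln (1 + m * x) / m \<le> 1" using y by linarith
    then show ?thesis by (simp only: exp_le_cancel_iff) (intro mult_left_mono, auto)
  qed
  finally have P1: "P \<le> exp (real q)" by simp
  \<comment> \<open>The multiplicative error \<open>exp \<delta>\<close> becomes additive:
    \<open>exp \<delta> - 1\<close> is at most \<open>\<delta> * exp K\<close>, and \<open>P\<close>
    is at most \<open>exp (real q)\<close>. Together they give the constant
    \<open>exp (real q + K)\<close>.\<close>
  define \<delta> where "\<delta> = K * y * x\<^sup>2"
  have "x\<^sup>2 \<le> 1" using y x by (simp add: power_le_one)
  then have "y * x\<^sup>2 \<le> 1 * 1" using y by (intro mult_mono) auto
  then have "K * (y * x\<^sup>2) \<le> K * 1" using K(2) by (intro mult_left_mono) auto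
  then have \<delta>: "\<delta> \<ge> 0" "\<delta> \<le> K" using K(2) y by (auto simp: \<delta>_def mult.assoc)
  have "1 - \<delta> \<le> exp (- \<delta>)" using exp_ge_add_one_self[of "- \<delta>"] by simp
  then have "exp \<delta> * (1 - \<delta>) \<le> exp \<delta> * exp (- \<delta>)" by (intro mult_left_mono) auto
  then have "exp \<delta> - 1 \<le> \<delta> * exp \<delta>" by (simp add: exp_minus algebra_simps)
  also have "\<dots> \<le> \<delta> * exp K" using \<delta> by (intro mult_left_mono) auto
  finally have "P * (exp \<delta> - 1) \<le> exp (real q) * (\<delta> * exp K)"
    using P0 P1 \<delta> by (intro mult_mono) auto
  then have "P * exp \<delta> \<le> P + exp (real q + K) * \<delta>"
    by (simp add: exp_add algebra_simps)
  with main have "Zq_scalar q (complete_graph (d + 1)) (\<lambda>_. x) powr (1 / n) \<le> P + exp (real q + K) * \<delta>"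
    unfolding \<delta>_def by (rule order.trans)
  moreover have "real (d + 1) = n" by (simp add: n_def)
  ultimately show ?thesis
    unfolding P_def[symmetric] n_def[symmetric] by (simp only: \<delta>_def y_def mult.assoc)
qed

section \<open>Uniform error terms and the asymptotic bounds\<close>

lemma vdegree_le_max_degree: "finite (verts G) \<Longrightarrow> v \<in> verts G \<Longrightarrow> vdegree G v \<le> max_degree G"
  by (simp add: max_degree_def)

(* The error term is the nonpositive part of the difference of the factor in the nonasymptotic
   bound and the factor in the asymptotic bound. *)
lemma error_term_exists:
  fixes G :: "'i \<Rightarrow> 'a graph" and P Q b :: "'i \<Rightarrow> 'a \<Rightarrow> real"
  assumes P: "\<And>n v. v \<in> verts (G n) \<Longrightarrow> P n v \<ge> 0" and Q: "\<And>n v. v \<in> verts (G n) \<Longrightarrow> Q n v \<ge> 0"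
    and bound: "\<And>n. (\<Prod>v\<in>verts (G n). P n v) \<le> B n"
    and err: "\<And>c. c > 0 \<Longrightarrow> \<forall>\<^sub>F n in F. \<forall>v\<in>verts (G n). Q n v \<le> P n v + c * b n v"
    and b: "\<And>n v. v \<in> verts (G n) \<Longrightarrow> b n v \<ge> 0"
  shows "\<exists>err. (\<lambda>(n, v). err n v) \<in> o[vertex_filter F G](\<lambda>(n, v). b n v) \<and>
    (\<forall>\<^sub>F n in F. B n \<ge> (\<Prod>v\<in>verts (G n). Q n v + err n v))"
proof (intro exI conjI)
  define err where "err n v = min 0 (P n v - Q n v)" for n v
  show "(\<lambda>(n, v). err n v) \<in> o[vertex_filter F G](\<lambda>(n, v). b n v)"
    unfolding smallo_vertex_filter
  proof (intro allI impI)
    fix c :: real assume "c > 0"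
    from err[OF this] show "\<forall>\<^sub>F n in F. \<forall>v\<in>verts (G n). \<bar>err n v\<bar> \<le> c * \<bar>b n v\<bar>"
    proof eventually_elim
      case (elim n)
      have "\<bar>err n v\<bar> \<le> c * \<bar>b n v\<bar>" if v: "v \<in> verts (G n)" for v
        using elim v b[OF v] mult_nonneg_nonneg[of c "b n v"] \<open>c > 0\<close> by (auto simp: err_def min_def)
      then show ?case by blast
    qed
  qed
  \<comment> \<open>Here \<open>Q n v + err n v\<close> is the minimum of \<open>Q n v\<close> and
    \<open>P n v\<close>, so it lies between 0 and \<open>P n v\<close> and the products compare
    factor by factor.\<close>
  have "(\<Prod>v\<in>verts (G n). Q n v + err n v) \<le> (\<Prod>v\<in>verts (G n). P n v)" for n
    using P Q by (intro prod_mono) (auto simp: err_def min_def)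
  then show "\<forall>\<^sub>F n in F. B n \<ge> (\<Prod>v\<in>verts (G n). Q n v + err n v)"
    using bound order.trans by (intro always_eventually allI) blast
qed

text \<open>Once the maximum degree is at least 1, \<open>vdegree (G n) v + q + 1\<close> is at most
  \<open>q + 2\<close> times it, and each of the finitely many fugacities is small compared with its
  reciprocal, uniformly in the vertex.\<close>

lemma eventually_small_fugacities:
  fixes G :: "'i \<Rightarrow> 'a graph" and lam :: "'i \<Rightarrow> nat \<Rightarrow> 'a \<Rightarrow> real"
  assumes "\<And>n. simple_graph (G n)"
    and nonneg: "\<And>n i v. i \<in> {1..q} \<Longrightarrow> v \<in> verts (G n) \<Longrightarrow> lam n i v \<ge> 0"
    and lim: "filterlim (\<lambda>n. max_degree (G n)) at_top F"
    and small: "\<And>i. i \<in> {1..q} \<Longrightarrow> (\<lambda>(n, v). lam n i v) \<in> o[vertex_filter F G](\<lambda>(n, v). 1 / real (max_degree (G n)))"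
    and e: "e > 0"
  shows "\<forall>\<^sub>F n in F. \<forall>v\<in>verts (G n).
    (real (vdegree (G n) v) + real q + 1) * (\<Sum>i=1..q. lam n i v) \<le> e"
proof -
  \<comment> \<open>The factor \<open>q\<close> counts the summands and \<open>q + 2\<close> comes
    from the degree bound; the added 1 keeps \<open>k\<close> positive for
    \<open>q = 0\<close>.\<close>
  define k where "k = real q * (real q + 2) + 1"
  have k: "k > 0" by (simp add: k_def add_nonneg_pos)
  have "\<forall>\<^sub>F n in F. \<forall>v\<in>verts (G n). \<bar>lam n i v\<bar> \<le> e / k * \<bar>1 / real (max_degree (G n))\<bar>" if "i \<in> {1..q}" for i
    using small[OF that] divide_pos_pos[OF e k] unfolding smallo_vertex_filter by blast
  then have "\<forall>\<^sub>F n in F. \<forall>i\<in>{1..q}. \<forall>v\<in>verts (G n). \<bar>lam n i v\<bar> \<le> e / k * \<bar>1 / real (max_degree (G n))\<bar>"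
    by (simp add: eventually_ball_finite_distrib)
  moreover have "\<forall>\<^sub>F n in F. max_degree (G n) \<ge> 1"
    using lim by (simp add: filterlim_at_top)
  ultimately show ?thesis
  proof eventually_elim
    case (elim n)
    show ?case
    proof
      fix v assume v: "v \<in> verts (G n)"
      define M where "M = real (max_degree (G n))"
      have M: "M \<ge> 1" using elim by (simp add: M_def)
      have "vdegree (G n) v \<le> max_degree (G n)"
        using assms(1) v by (intro vdegree_le_max_degree) (auto simp: simple_graph_def)
      then have d: "real (vdegree (G n) v) \<le> M" by (simp add: M_def)
      have "(\<Sum>i=1..q. lam n i v) \<le> (\<Sum>i=1..q. e / k * (1 / M))"
        using elim(1) v M by (intro sum_mono) (force simp: M_def)
      then have s: "(\<Sum>i=1..q. lam n i v) \<le> real q * (e / k / M)" by simp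
      have "real q + 1 \<le> (real q + 1) * M" using mult_left_mono[OF M, of "real q + 1"] by simp
      then have "real (vdegree (G n) v) + real q + 1 \<le> (real q + 2) * M" using d by (simp add: algebra_simps)
      then have "(real (vdegree (G n) v) + real q + 1) * (\<Sum>i=1..q. lam n i v) \<le> ((real q + 2) * M) * (real q * (e / k / M))"
        using s nonneg v M by (intro mult_mono sum_nonneg) auto
      also have "\<dots> = (real q * (real q + 2)) * e / k" using M by simp
      also have "\<dots> \<le> k * e / k" using e k by (intro divide_right_mono mult_right_mono) (auto simp: k_def)
      also have "\<dots> = e" using k by simp
      finally show "(real (vdegree (G n) v) + real q + 1) * (\<Sum>i=1..q. lam n i v) \<le> e" .
    qed
  qed
qed

text \<open>Each o-term is an error function \<open>err\<close> that may depend on the whole family,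
  and \<open>vertex_filter\<close> makes its estimate uniform over the vertices. The filter
  \<open>F\<close> covers sequences of graphs as well as more general families.\<close>

theorem theorem4p3:
  fixes q :: nat
  assumes "q \<ge> 1"
  shows
    "(\<forall>(G :: 'a graph) (lam :: nat \<Rightarrow> 'a \<Rightarrow> real).
        simple_graph G \<longrightarrow>
        (\<forall>i\<in>{1..q}. \<forall>v\<in>verts G. lam i v \<ge> 0) \<longrightarrow>
        Zq q G lam \<ge>
          (\<Prod>v\<in>verts G. \<Prod>i=1..q.
             Z (complete_graph (vdegree G v + q)) (lam i v) powr (1 / real (vdegree G v + q))))
     \<and>
     (\<forall>(F :: 'i filter) (G :: 'i \<Rightarrow> 'a graph) (lam :: 'i \<Rightarrow> nat \<Rightarrow> 'a \<Rightarrow> real).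
        (\<forall>n. simple_graph (G n)) \<longrightarrow>
        (\<forall>n. \<forall>i\<in>{1..q}. \<forall>v\<in>verts (G n). lam n i v \<ge> 0) \<longrightarrow>
        filterlim (\<lambda>n. max_degree (G n)) at_top F \<longrightarrow>
        (\<forall>i\<in>{1..q}. (\<lambda>(n, v). lam n i v)
            \<in> o[vertex_filter F G](\<lambda>(n, v). 1 / real (max_degree (G n)))) \<longrightarrow>
        (\<exists>err :: 'i \<Rightarrow> 'a \<Rightarrow> real.
           (\<lambda>(n, v). err n v) \<in> o[vertex_filter F G](\<lambda>(n, v). \<Sum>i=1..q. lam n i v) \<and>
           (\<forall>\<^sub>F n in F.
              Zq q (G n) (lam n) \<ge>
                (\<Prod>v\<in>verts (G n).
                   Zq_scalar q (complete_graph (vdegree (G n) v + 1)) (\<lambda>i. lam n i v)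
                     powr (1 / real (vdegree (G n) v + 1))
                   + err n v)))
        \<and>
        (\<forall>lam' :: 'i \<Rightarrow> 'a \<Rightarrow> real.
           (\<forall>n. \<forall>v\<in>verts (G n). \<forall>i\<in>{1..q}. lam n i v = lam' n v) \<longrightarrow>
           (\<exists>err :: 'i \<Rightarrow> 'a \<Rightarrow> real.
              (\<lambda>(n, v). err n v) \<in> o[vertex_filter F G](\<lambda>(n, v). (real q * lam' n v)\<^sup>2) \<and>
              (\<forall>\<^sub>F n in F.
                 Zq q (G n) (lam n) \<ge>
                   (\<Prod>v\<in>verts (G n).
                      Zq_scalar q (complete_graph (vdegree (G n) v + 1)) (\<lambda>_. lam' n v)
                        powr (1 / real (vdegree (G n) v + 1))
                      + err n v)))))"
proof (intro conjI allI impI)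
  fix G :: "'a graph" and lam :: "nat \<Rightarrow> 'a \<Rightarrow> real"
  assume G: "simple_graph G" "\<forall>i\<in>{1..q}. \<forall>v\<in>verts G. lam i v \<ge> 0"
  have "Z (complete_graph (vdegree G v + q)) x powr (1 / real (vdegree G v + q)) = hc_factor (vdegree G v + (q - 1)) x" for v x
  proof -
    \<comment> \<open>\<open>hc_factor\<close> adds one to its degree argument, so the degree
      \<open>d_v + q - 1\<close> in the product graph yields the \<open>(d_v + q)\<close>-th
      root.\<close>
    have "real (vdegree G v + q) = real (vdegree G v + (q - 1)) + 1" using assms by (simp add: of_nat_diff)
    then show ?thesis by (simp only: Z_complete_graph hc_factor_def)
  qed
  then show "(\<Prod>v\<in>verts G. \<Prod>i=1..q.
      Z (complete_graph (vdegree G v + q)) (lam i v) powr (1 / real (vdegree G v + q))) \<le> Zq q G lam"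
    using Zq_lower_bound[of G q lam] G by simp
next
  fix F :: "'i filter" and G :: "'i \<Rightarrow> 'a graph" and lam :: "'i \<Rightarrow> nat \<Rightarrow> 'a \<Rightarrow> real"
  assume G: "\<forall>n. simple_graph (G n)"
    and nonneg: "\<forall>n. \<forall>i\<in>{1..q}. \<forall>v\<in>verts (G n). lam n i v \<ge> 0"
    and lim: "filterlim (\<lambda>n. max_degree (G n)) at_top F"
    and small: "\<forall>i\<in>{1..q}. (\<lambda>(n, v). lam n i v) \<in> o[vertex_filter F G](\<lambda>(n, v). 1 / real (max_degree (G n)))"
  define s where "s n v = (\<Sum>i=1..q. lam n i v)" for n v
  have s: "s n v \<ge> 0" if "v \<in> verts (G n)" for n v
    unfolding s_def using nonneg that by (intro sum_nonneg) auto
  have smallF: "\<forall>\<^sub>F n in F. \<forall>v\<in>verts (G n). (real (vdegree (G n) v) + real q + 1) * s n v \<le> e" if "e > 0" for e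
    unfolding s_def using G nonneg lim small that by (intro eventually_small_fugacities) auto
  have bound: "(\<Prod>v\<in>verts (G n). \<Prod>i=1..q. hc_factor (vdegree (G n) v + (q - 1)) (lam n i v)) \<le> Zq q (G n) (lam n)" for n
    using G nonneg by (intro Zq_lower_bound) auto
  have P0: "(\<Prod>i=1..q. hc_factor (vdegree (G n) v + (q - 1)) (lam n i v)) \<ge> 0" if "v \<in> verts (G n)" for n v
    using nonneg that by (auto intro!: prod_nonneg less_imp_le[OF hc_factor_pos])
  show "\<exists>err. (\<lambda>(n, v). err n v) \<in> o[vertex_filter F G](\<lambda>(n, v). \<Sum>i=1..q. lam n i v) \<and>
      (\<forall>\<^sub>F n in F. Zq q (G n) (lam n) \<ge> (\<Prod>v\<in>verts (G n).
        Zq_scalar q (complete_graph (vdegree (G n) v + 1)) (\<lambda>i. lam n i v) powr (1 / real (vdegree (G n) v + 1)) + err n v))"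
    unfolding s_def[symmetric]
  proof (rule error_term_exists[OF P0 _ bound _ s])
    fix c :: real assume c: "c > 0"
    show "\<forall>\<^sub>F n in F. \<forall>v\<in>verts (G n).
        Zq_scalar q (complete_graph (vdegree (G n) v + 1)) (\<lambda>i. lam n i v) powr (1 / real (vdegree (G n) v + 1))
        \<le> (\<Prod>i=1..q. hc_factor (vdegree (G n) v + (q - 1)) (lam n i v)) + c * s n v"
      using smallF[OF c] smallF[OF zero_less_one]
    proof eventually_elim
      case (elim n)
      show ?case
      proof
        fix v assume v: "v \<in> verts (G n)"
        let ?d = "vdegree (G n) v"
        have "(real ?d + real q) * s n v \<le> 1"
          using elim(2) v s[OF v] by (auto simp: distrib_right)
        then have "Zq_scalar q (complete_graph (?d + 1)) (\<lambda>i. lam n i v) powr (1 / real (?d + 1))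
            \<le> (\<Prod>i=1..q. hc_factor (?d + (q - 1)) (lam n i v)) + (real ?d + real q + 1) * (s n v)\<^sup>2"
          unfolding s_def using assms nonneg v by (intro Zq_scalar_root_le_general) auto
        \<comment> \<open>One factor \<open>s n v\<close> of the quadratic error absorbs the degree,
          leaving an arbitrarily small multiple of \<open>s n v\<close>.\<close>
        moreover have "(real ?d + real q + 1) * s n v * s n v \<le> c * s n v"
          using elim(1) v s[OF v] by (intro mult_right_mono) auto
        ultimately show "Zq_scalar q (complete_graph (?d + 1)) (\<lambda>i. lam n i v) powr (1 / real (?d + 1))
            \<le> (\<Prod>i=1..q. hc_factor (?d + (q - 1)) (lam n i v)) + c * s n v"
          by (simp only: power2_eq_square mult.assoc)
      qed
    qed
  qed auto
  fix lam' :: "'i \<Rightarrow> 'a \<Rightarrow> real"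
  assume eq: "\<forall>n. \<forall>v\<in>verts (G n). \<forall>i\<in>{1..q}. lam n i v = lam' n v"
  have lam': "lam' n v \<ge> 0" "s n v = real q * lam' n v"
    "(\<Prod>i=1..q. hc_factor (vdegree (G n) v + (q - 1)) (lam n i v)) = (\<Prod>i=1..q. hc_factor (vdegree (G n) v + (q - 1)) (lam' n v))"
    if "v \<in> verts (G n)" for n v
  proof -
    have l: "lam n i v = lam' n v" if "i \<in> {1..q}" for i using eq \<open>v \<in> verts (G n)\<close> that by blast
    show "lam' n v \<ge> 0" using l[of 1] nonneg that assms by force
    show "s n v = real q * lam' n v" using l by (simp add: s_def)
    show "(\<Prod>i=1..q. hc_factor (vdegree (G n) v + (q - 1)) (lam n i v)) = (\<Prod>i=1..q. hc_factor (vdegree (G n) v + (q - 1)) (lam' n v))"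
      using l by (intro prod.cong) auto
  qed
  show "\<exists>err. (\<lambda>(n, v). err n v) \<in> o[vertex_filter F G](\<lambda>(n, v). (real q * lam' n v)\<^sup>2) \<and>
      (\<forall>\<^sub>F n in F. Zq q (G n) (lam n) \<ge> (\<Prod>v\<in>verts (G n).
        Zq_scalar q (complete_graph (vdegree (G n) v + 1)) (\<lambda>_. lam' n v) powr (1 / real (vdegree (G n) v + 1)) + err n v))"
  proof (rule error_term_exists[OF P0 _ bound])
    fix c :: real assume c: "c > 0"
    define K where "K = real (q choose 2) * real q"
    define C where "C = exp (real q + K) * K"
    have C: "C \<ge> 0" by (simp add: C_def K_def)
    \<comment> \<open>Adding 1 avoids a division by zero: for \<open>q = 1\<close> the constant
      \<open>C\<close> is 0.\<close>
    then have "c / (C + 1) > 0" using c by simp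
    from smallF[OF this] smallF[OF zero_less_one]
    show "\<forall>\<^sub>F n in F. \<forall>v\<in>verts (G n).
        Zq_scalar q (complete_graph (vdegree (G n) v + 1)) (\<lambda>_. lam' n v) powr (1 / real (vdegree (G n) v + 1))
        \<le> (\<Prod>i=1..q. hc_factor (vdegree (G n) v + (q - 1)) (lam n i v)) + c * (real q * lam' n v)\<^sup>2"
    proof eventually_elim
      case (elim n)
      show ?case
      proof
        fix v assume v: "v \<in> verts (G n)"
        let ?d = "vdegree (G n) v" and ?x = "lam' n v"
        have x: "?x \<ge> 0" using lam'(1)[OF v] .
        have xs: "?x \<le> s n v" using lam'(2)[OF v] mult_right_mono[of 1 "real q" ?x] x assms by simp
        \<comment> \<open>This quantity is the extra factor in the error of
          \<open>Zq_scalar_root_le_uniform\<close>; its smallness turns that error into an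
          arbitrarily small multiple of \<open>?x\<^sup>2\<close>.\<close>
        have y: "(real ?d + 1) * ?x \<le> (real ?d + real q + 1) * s n v"
          using x xs by (intro mult_mono) auto
        have y1: "(real ?d + 1) * ?x \<le> 1" and yc: "(real ?d + 1) * ?x \<le> c / (C + 1)"
          using order.trans[OF y] elim v by auto
        have "C * ((real ?d + 1) * ?x) \<le> C * (c / (C + 1))"
          using yc C by (rule mult_left_mono)
        also have "\<dots> \<le> c" using C c by (simp add: divide_le_eq algebra_simps)
        finally have "C * ((real ?d + 1) * ?x) * ?x\<^sup>2 \<le> c * ?x\<^sup>2" by (intro mult_right_mono) auto
        also have "\<dots> \<le> c * (real q * ?x)\<^sup>2"
          using c x xs lam'(2)[OF v] by (intro mult_left_mono power_mono) auto
        finally show "Zq_scalar q (complete_graph (?d + 1)) (\<lambda>_. ?x) powr (1 / real (?d + 1))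
            \<le> (\<Prod>i=1..q. hc_factor (?d + (q - 1)) (lam n i v)) + c * (real q * ?x)\<^sup>2"
          using Zq_scalar_root_le_uniform[OF assms x y1] unfolding lam'(3)[OF v] C_def K_def
          by linarith
      qed
    qed
  qed auto
qed

end
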